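(* Let $\vec n\in\mathbb N_0^p$, $\vec m\in\mathbb N_0^q$ with $|\vec m|=|\vec n|-1$. Up to a nonzero constant common to all components, the components of the type-I mixed Piñeiro form are, for every $i\in\{1,\ldots,p\}$ with $n_i\ge1$, $$A^{(i)}_{\vec n,\vec m}(x)=\frac{\prod_{j=1}^q(\alpha_i+\beta_j+1)_{m_j}}{(n_i-1)!\prod_{j=1,j\ne i}^p(\alpha_j-\alpha_i)_{n_j}}\;{}_{p+q}F_{p+q-1}\!\left[\begin{matrix}-n_i+1,\ \{\alpha_i+\beta_k+m_k+1\}_{k=1}^q,\ \{\alpha_i-\alpha_k-n_k+1\}_{k=1,k\ne i}^p\\ \{\alpha_i+\beta_k+1\}_{k=1}^q,\ \{\alpha_i-\alpha_k+1\}_{k=1,k\ne i}^p\end{matrix};x\right].$$ The coefficient of $x^k$ in $A^{(i)}_{\vec n,\vec m}$, $0\le k\le n_i-1$, is $$A^{(i)}_{\vec n,\vec m}[k]=\frac{\prod_{j=1}^q(\alpha_i+k+\beta_j+1)_{m_j}}{\prod_{j=1,j\ne i}^p(\alpha_j-\alpha_i-k)_{n_j}\;k!\,(n_i-k-1)!\,(-1)^k},$$ and the leading coefficient is $$A^{(i)}_{\vec n,\vec m}[n_i-1]=\frac{\prod_{j=1}^q(\alpha_i+n_i+\beta_j)_{m_j}}{\prod_{j=1,j\ne i}^p(\alpha_j-\alpha_i-n_i+1)_{n_j}\,(n_i-1)!\,(-1)^{n_i-1}}.$$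
   Context: $p,q\ge1$; real parameters satisfy $\alpha_i>-1$, $\beta_j>-1$, $\alpha_i+\beta_j>-1$ for all $1\le i\le p$, $1\le j\le q$; $\alpha_i-\alpha_h\notin\mathbb Z$ for $i\ne h$ and $\beta_j-\beta_s\notin\mathbb Z$ for $j\neq s$. $(z)_0=1$, $(z)_n=\prod_{r=0}^{n-1}(z+r)$; $|\cdot|$ is the sum of components of a multi-index. ${}_aF_b\left[\begin{smallmatrix}a_1,\ldots,a_a\\ c_1,\ldots,c_b\end{smallmatrix};x\right]=\sum_{l\ge0}\frac{(a_1)_l\cdots(a_a)_l}{(c_1)_l\cdots(c_b)_l}\frac{x^l}{l!}$ (terminating here). For $|\vec n|=|\vec m|+1$, the type-I mixed Piñeiro form is the nonzero function $A_{\vec n,\vec m}(x)=\sum_{i=1}^pA^{(i)}_{\vec n,\vec m}(x)x^{\alpha_i}$ with polynomials $\deg A^{(i)}_{\vec n,\vec m}\le n_i-1$ ($A^{(i)}\equiv0$ if $n_i=0$) such that $\int_0^1A_{\vec n,\vec m}(x)x^{k+\beta_j}\,\mathrm dx=0$ for $0\le k\le m_j-1$, $1\le j\le q$; it is unique up to a nonzero constant factor (known perfectness of the system). The common constant for which the formulas hold exactly is that of the contour normalization $A_{\vec n,\vec m}(x)=\int_\Sigma\frac{x^t\prod_{j}(t+\beta_j+1)_{m_j}}{\prod_{i}(\alpha_i-t)_{n_i}}\frac{\mathrm dt}{2\pi\mathrm i}$, with $\Sigma$ clockwise enclosing once exactly the poles $\alpha_i+k$, $0\le k\le n_i-1$,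 $1\le i\le p$. *)

theory Defs
  imports "HOL-Complex_Analysis.Complex_Analysis"
begin

definition pineiro_form :: "nat \<Rightarrow> (nat \<Rightarrow> real) \<Rightarrow> (nat \<Rightarrow> real poly) \<Rightarrow> real \<Rightarrow> real" where
  "pineiro_form p \<alpha> A x = (\<Sum>i=1..p. poly (A i) x * x powr \<alpha> i)"

text \<open>The orthogonality relations use \<^const>\<open>has_integral\<close>, so that integrability on the unit
  interval is part of the condition (\<^const>\<open>integral\<close> is \<open>0\<close> on non-integrable functions).
  Only the components \<open>A 1, \<dots>, A p\<close> matter.\<close>

definition type_I_pineiro ::
  "nat \<Rightarrow> nat \<Rightarrow> (nat \<Rightarrow> real) \<Rightarrow> (nat \<Rightarrow> real) \<Rightarrow> (nat \<Rightarrow> nat) \<Rightarrow> (nat \<Rightarrow> nat) \<Rightarrow> (nat \<Rightarrow> real poly) \<Rightarrow> bool"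
  where
  "type_I_pineiro p q \<alpha> \<beta> n m A \<longleftrightarrow>
     (\<forall>i\<in>{1..p}. if n i = 0 then A i = 0 else degree (A i) \<le> n i - 1) \<and>
     (\<exists>x\<in>{0<..<1}. pineiro_form p \<alpha> A x \<noteq> 0) \<and>
     (\<forall>j\<in>{1..q}. \<forall>k<m j.
        ((\<lambda>x. pineiro_form p \<alpha> A x * x powr (real k + \<beta> j)) has_integral 0) {0..1})"

definition pineiro_poles :: "nat \<Rightarrow> (nat \<Rightarrow> real) \<Rightarrow> (nat \<Rightarrow> nat) \<Rightarrow> complex set" where
  "pineiro_poles p \<alpha> n = {complex_of_real (\<alpha> i + real k) | i k. i \<in> {1..p} \<and> k < n i}"

definition clockwise_once_around :: "(real \<Rightarrow> complex) \<Rightarrow> complex set \<Rightarrow> bool" where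
  "clockwise_once_around \<Sigma> S \<longleftrightarrow>
     valid_path \<Sigma> \<and> pathfinish \<Sigma> = pathstart \<Sigma> \<and> path_image \<Sigma> \<inter> S = {} \<and>
     (\<forall>z\<in>S. winding_number \<Sigma> z = -1)"

text \<open>For \<open>x > 0\<close> the integrand below is holomorphic off \<^const>\<open>pineiro_poles\<close>, so a contour
  winding once clockwise around these points encloses no other singularity.\<close>

definition pineiro_contour_normalized ::
  "nat \<Rightarrow> nat \<Rightarrow> (nat \<Rightarrow> real) \<Rightarrow> (nat \<Rightarrow> real) \<Rightarrow> (nat \<Rightarrow> nat) \<Rightarrow> (nat \<Rightarrow> nat) \<Rightarrow>
     (real \<Rightarrow> complex) \<Rightarrow> (nat \<Rightarrow> real poly) \<Rightarrow> bool"
  where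
  "pineiro_contour_normalized p q \<alpha> \<beta> n m \<Sigma> A \<longleftrightarrow>
     (\<forall>x>0.
        ((\<lambda>t. complex_of_real x powr t *
               (\<Prod>j=1..q. pochhammer (t + of_real (\<beta> j) + 1) (m j)) /
               (\<Prod>i=1..p. pochhammer (of_real (\<alpha> i) - t) (n i)) /
               (2 * of_real pi * \<i>))
          has_contour_integral of_real (pineiro_form p \<alpha> A x)) \<Sigma>)"

end

theory Submission
  imports Defs
begin

text \<open>
  Expand the form as \<open>\<Sum> c\<^sub>s x powr a\<^sub>s\<close> over the \<open>|n|\<close> pairwise distinct exponents \<open>a\<^sub>s = \<alpha>\<^sub>i + k\<close>.
  Integrating termwise, orthogonality says that the rational function \<open>\<Sum> c\<^sub>s / (a\<^sub>s - t)\<close> vanishes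
  at the \<open>|m| = |n| - 1\<close> distinct points \<open>b\<^sub>r = - (\<beta>\<^sub>j + k + 1)\<close>. Its numerator has degree less than
  \<open>|n|\<close>, hence is a constant multiple of \<open>\<Prod> (t - b\<^sub>r)\<close>, and evaluating it at the poles gives the
  coefficients; Lagrange interpolation gives the converse. The contour integral is computed from
  the same partial fraction decomposition by Cauchy's integral formula.
\<close>

section \<open>Partial fractions with simple poles and the homogeneous Cauchy system\<close>

text \<open>Multiplying the sum of \<open>c s / (a s - t)\<close> over \<open>S\<close> by the
  product of all \<open>a s - t\<close> leaves this polynomial in \<open>t\<close>. Unlike the
  rational function, it can be evaluated at the nodes themselves.\<close>

definition cauchy_numerator :: "('b \<Rightarrow> 'a::field) \<Rightarrow> ('b \<Rightarrow> 'a) \<Rightarrow> 'b set \<Rightarrow> 'a poly" where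
  "cauchy_numerator a c S = (\<Sum>s\<in>S. smult (c s) (\<Prod>r\<in>S - {s}. [:a r, -1:]))"

lemma degree_cauchy_numerator:
  assumes "finite S" "S \<noteq> {}"
  shows "degree (cauchy_numerator a c S) < card S"
proof -
  have "degree (\<Prod>r\<in>S - {s}. [:a r, -1:]) \<le> card S - 1" if "s \<in> S" for s
  proof -
    have "degree (\<Prod>r\<in>S - {s}. [:a r, -1:]) \<le> (\<Sum>r\<in>S - {s}. 1)"
      using degree_prod_sum_le[of "S - {s}" "\<lambda>r. [:a r, -1:]"] assms(1)
      by (simp add: o_def)
    also have "\<dots> = card S - 1"
      using that assms(1) by simp
    finally show ?thesis .
  qed
  then have "degree (cauchy_numerator a c S) \<le> card S - 1"
    unfolding cauchy_numerator_def
    by (intro degree_sum_le assms(1)) (meson degree_smult_le le_trans)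
  moreover have "card S > 0"
    using assms by (simp add: card_gt_0_iff)
  ultimately show ?thesis
    by linarith
qed

text \<open>At the node \<open>a s\<close> every summand of another index contains the factor
  \<open>a s - a s\<close>. The value therefore recovers \<open>c s\<close> once the nodes are
  distinct.\<close>

lemma poly_cauchy_numerator_node:
  assumes "finite S" "s \<in> S"
  shows "poly (cauchy_numerator a c S) (a s) = c s * (\<Prod>r\<in>S - {s}. a r - a s)"
proof -
  have "(\<Sum>u\<in>S - {s}. c u * (\<Prod>r\<in>S - {u}. a r - a s)) = 0"
    using assms by (intro sum.neutral ballI) (auto intro!: prod_zero)
  then show ?thesis
    using assms by (simp add: cauchy_numerator_def poly_sum poly_prod sum.remove[OF assms])
qed

lemma poly_cauchy_numerator:
  assumes "finite S" "t \<notin> a ` S"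
  shows "poly (cauchy_numerator a c S) t = (\<Sum>s\<in>S. c s / (a s - t)) * (\<Prod>s\<in>S. a s - t)"
proof -
  have "c s * (\<Prod>r\<in>S - {s}. a r - t) = c s / (a s - t) * (\<Prod>r\<in>S. a r - t)" if "s \<in> S" for s
  proof -
    have "a s - t \<noteq> 0"
      using assms(2) that by auto
    then show ?thesis
      by (simp add: prod.remove[OF assms(1) that])
  qed
  then show ?thesis
    by (simp add: cauchy_numerator_def poly_sum poly_prod sum_distrib_right)
qed

lemma prod_node_differences_nonzero:
  fixes a :: "'b \<Rightarrow> 'a::field"
  assumes "finite S" "inj_on a S" "s \<in> S"
  shows "(\<Prod>r\<in>S - {s}. a r - a s) \<noteq> 0"
  using assms by (auto dest: inj_onD)

text \<open>Lagrange interpolation: the chosen coefficients cancel the node factor of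
  \<open>poly_cauchy_numerator_node\<close>, so two polynomials of degree below
  \<open>card S\<close> agree at \<open>card S\<close> distinct nodes.\<close>

lemma cauchy_numerator_interpolation:
  assumes "finite S" "inj_on a S" "degree P < card S"
  shows "cauchy_numerator a (\<lambda>s. poly P (a s) / (\<Prod>r\<in>S - {s}. a r - a s)) S = P"
proof (rule poly_eqI_degree[of "a ` S"])
  have "S \<noteq> {}"
    using assms(3) by auto
  then show "degree (cauchy_numerator a (\<lambda>s. poly P (a s) / (\<Prod>r\<in>S - {s}. a r - a s)) S) < card (a ` S)"
    using assms by (simp add: card_image degree_cauchy_numerator)
next
  show "poly (cauchy_numerator a (\<lambda>s. poly P (a s) / (\<Prod>r\<in>S - {s}. a r - a s)) S) x = poly P x"
    if "x \<in> a ` S" for x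
    using that assms prod_node_differences_nonzero[OF assms(1,2)]
    by (auto simp: poly_cauchy_numerator_node)
qed (use assms in \<open>simp add: card_image\<close>)

corollary partial_fractions:
  fixes a :: "'b \<Rightarrow> 'a::field"
  assumes "finite S" "inj_on a S" "degree P < card S" "t \<notin> a ` S"
  shows "poly P t / (\<Prod>s\<in>S. a s - t) =
    (\<Sum>s\<in>S. poly P (a s) / (\<Prod>r\<in>S - {s}. a r - a s) / (a s - t))"
proof -
  have "(\<Prod>s\<in>S. a s - t) \<noteq> 0"
    using assms(1,4) by (auto simp: image_iff)
  then show ?thesis
    using poly_cauchy_numerator[OF assms(1,4), of "\<lambda>s. poly P (a s) / (\<Prod>r\<in>S - {s}. a r - a s)"]
    by (simp add: cauchy_numerator_interpolation[OF assms(1-3)] nonzero_divide_eq_eq)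
qed

lemma cauchy_numerator_eq_0D:
  assumes "finite S" "inj_on a S" "cauchy_numerator a c S = 0" "s \<in> S"
  shows "c s = 0"
  using poly_cauchy_numerator_node[OF assms(1,4), of a c]
    prod_node_differences_nonzero[OF assms(1,2,4)] assms(3) by simp

lemma degree_prod_linear:
  fixes b :: "'b \<Rightarrow> 'a::field"
  shows "degree (\<Prod>r\<in>T. [:- b r, 1:]) = card T"
  by (subst degree_prod_eq_sum_degree) auto

text \<open>There is one equation fewer than there are unknowns. Each equation makes
  \<open>b r\<close> a zero of the numerator, whose degree is at most \<open>card T\<close>, so the
  numerator is a multiple of the monic polynomial with these zeros. Its node values then return the
  coefficients.\<close>

lemma cauchy_system_solution:
  fixes a :: "'b \<Rightarrow> 'a::field"
  assumes S: "finite S" "inj_on a S" and T: "finite T" "inj_on b T"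
    and card: "card S = card T + 1" and disj: "a ` S \<inter> b ` T = {}"
    and zero: "\<And>r. r \<in> T \<Longrightarrow> (\<Sum>s\<in>S. c s / (a s - b r)) = 0"
  shows "\<exists>C. \<forall>s\<in>S.
    c s = C * (poly (\<Prod>r\<in>T. [:- b r, 1:]) (a s) / (\<Prod>r\<in>S - {s}. a r - a s))"
proof -
  define U where "U = cauchy_numerator a c S"
  define P where "P = (\<Prod>r\<in>T. [:- b r, 1:])"
  obtain s0 where s0: "s0 \<in> S"
    using card by fastforce
  have P0: "poly P (a s0) \<noteq> 0"
    using disj s0 T by (auto simp: P_def poly_prod)
  \<comment> \<open>This choice forces agreement at the node \<open>a s0\<close>. Together with the
    common zeros there are \<open>card S\<close> points of agreement, more than either
    degree.\<close>
  define C where "C = poly U (a s0) / poly P (a s0)"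
  have "U = smult C P"
  proof (rule poly_eqI_degree[of "insert (a s0) (b ` T)"])
    have c: "card (insert (a s0) (b ` T)) = card S"
      using T disj s0 card by (subst card_insert_disjoint) (auto simp: card_image)
    show "degree U < card (insert (a s0) (b ` T))"
      unfolding c U_def using S s0 by (intro degree_cauchy_numerator) auto
    have "degree P = card T"
      unfolding P_def by (rule degree_prod_linear)
    then show "degree (smult C P) < card (insert (a s0) (b ` T))"
      unfolding c using card degree_smult_le[of C P] by linarith
    show "poly U x = poly (smult C P) x" if x: "x \<in> insert (a s0) (b ` T)" for x
    proof (cases "x = a s0")
      case True
      then show ?thesis
        using P0 by (simp add: C_def)
    next
      case False
      then obtain r where r: "r \<in> T" "x = b r"
        using x by auto
      have "poly U x = 0"
        unfolding U_def r(2) using r(1) disj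
        by (subst poly_cauchy_numerator) (auto simp: S zero)
      moreover have "poly P x = 0"
        using r T by (auto simp: P_def poly_prod intro!: prod_zero)
      ultimately show ?thesis
        by simp
    qed
  qed
  then have "c s = C * (poly P (a s) / (\<Prod>r\<in>S - {s}. a r - a s))" if "s \<in> S" for s
    using poly_cauchy_numerator_node[OF S(1) that, of a c]
      prod_node_differences_nonzero[OF S that] by (simp add: U_def field_simps)
  then show ?thesis
    unfolding P_def by blast
qed

section \<open>Integrals of sums of real powers\<close>

text \<open>Each term integrates to \<open>c s / (a s + e + 1)\<close>. Writing the denominator as a
  difference exhibits the integral as the partial fraction sum at
  \<open>t = - (e + 1)\<close>.\<close>

lemma has_integral_powr_sum:
  fixes a c :: "'b \<Rightarrow> real"
  assumes "finite S" "\<And>s. s \<in> S \<Longrightarrow> a s + e > -1"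
  shows "((\<lambda>x. (\<Sum>s\<in>S. c s * x powr a s) * x powr e) has_integral
    (\<Sum>s\<in>S. c s / (a s - (- (e + 1))))) {0..1}"
proof -
  have "((\<lambda>x. \<Sum>s\<in>S. c s * x powr (a s + e)) has_integral (\<Sum>s\<in>S. c s * (1 / (a s + e + 1)))) {0..1}"
  proof (intro has_integral_sum has_integral_mult_right assms(1))
    show "((\<lambda>x. x powr (a s + e)) has_integral 1 / (a s + e + 1)) {0..1}" if "s \<in> S" for s
      using has_integral_powr_from_0[of "a s + e" 1] assms(2)[OF that] by simp
  qed
  moreover have "a s - (- (e + 1)) = a s + e + 1" for s
    by simp
  ultimately show ?thesis
    by (simp only: powr_add sum_distrib_right mult.assoc times_divide_eq_right mult_1_right)
qed

text \<open>The moments of a vanishing combination show that its Cauchy numerator has infinitely many zeros.\<close>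

lemma powr_linearly_independent:
  fixes a c :: "'b \<Rightarrow> real"
  assumes S: "finite S" "inj_on a S" "\<And>s. s \<in> S \<Longrightarrow> a s > -1"
    and zero: "\<And>x. x \<in> {0<..<1} \<Longrightarrow> (\<Sum>s\<in>S. c s * x powr a s) = 0" and s: "s \<in> S"
  shows "c s = 0"
proof -
  have mom: "(\<Sum>s\<in>S. c s / (a s - (- (real k + 1)))) = 0" for k
  proof -
    have "((\<lambda>x. (\<Sum>s\<in>S. c s * x powr a s) * x powr real k) has_integral 0) {0..1}"
    \<comment> \<open>The combination is known to vanish only on the open interval; the two
      endpoints do not affect the integral.\<close>
    proof (rule has_integral_spike_finite[of "{0,1}"])
      show "(\<Sum>s\<in>S. c s * x powr a s) * x powr real k = 0" if "x \<in> {0..1} - {0,1}" for x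
        using zero[of x] that by simp
    qed auto
    moreover have "((\<lambda>x. (\<Sum>s\<in>S. c s * x powr a s) * x powr real k) has_integral
        (\<Sum>s\<in>S. c s / (a s - (- (real k + 1))))) {0..1}"
    proof (rule has_integral_powr_sum[OF S(1)])
      show "a s + real k > -1" if "s \<in> S" for s
        using S(3)[OF that] by linarith
    qed
    ultimately show ?thesis
      using has_integral_unique by blast
  qed
  have "cauchy_numerator a c S = 0"
  \<comment> \<open>The first \<open>card S\<close> moments already outnumber the degree. The points
    \<open>- (real k + 1)\<close> are at most -1, so they lie to the left of every node.\<close>
  proof (rule poly_eqI_degree[of "(\<lambda>k. - (real k + 1)) ` {..<card S}"])
    have c: "card ((\<lambda>k. - (real k + 1)) ` {..<card S}) = card S"
      by (subst card_image) (auto simp: inj_on_def)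
    show "degree (cauchy_numerator a c S) < card ((\<lambda>k. - (real k + 1)) ` {..<card S})"
      unfolding c using S s by (intro degree_cauchy_numerator) auto
    show "degree (0 :: real poly) < card ((\<lambda>k. - (real k + 1)) ` {..<card S})"
      unfolding c using S s by (auto simp: card_gt_0_iff)
    show "poly (cauchy_numerator a c S) x = poly 0 x"
      if x: "x \<in> (\<lambda>k. - (real k + 1)) ` {..<card S}" for x
    proof -
      obtain k where k: "x = - (real k + 1)"
        using x by auto
      have "x \<notin> a ` S"
        using S(3) unfolding k by force
      then show ?thesis
        using mom[of k] S(1) by (simp add: poly_cauchy_numerator k)
    qed
  qed
  then show ?thesis
    by (rule cauchy_numerator_eq_0D[OF S(1,2) _ s])
qed

section \<open>Contour integrals of partial fractions\<close>

text \<open>Cauchy's integral formula for the entire function \<open>f\<close>, applied to each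
  pole. The winding number -1 cancels the sign from \<open>a s - t = - (t - a s)\<close>, so no sign
  remains in the result.\<close>

lemma has_contour_integral_partial_fractions:
  fixes a c :: "'b \<Rightarrow> complex"
  assumes "finite S" "clockwise_once_around \<Sigma> (a ` S)" "f holomorphic_on UNIV"
  shows "((\<lambda>t. f t * (\<Sum>s\<in>S. c s / (a s - t)) / (2 * of_real pi * \<i>)) has_contour_integral
    (\<Sum>s\<in>S. c s * f (a s))) \<Sigma>"
proof -
  define w where "w = 2 * of_real pi * \<i>"
  have w: "w \<noteq> 0"
    by (simp add: w_def)
  have "((\<lambda>t. f t * (c s / (a s - t)) / w) has_contour_integral c s * f (a s)) \<Sigma>"
    if s: "s \<in> S" for s
  proof -
    have "((\<lambda>t. f t / (t - a s)) has_contour_integral w * winding_number \<Sigma> (a s) * f (a s)) \<Sigma>"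
      using Cauchy_integral_formula_convex_simple[of UNIV f "a s" \<Sigma>] assms s
      by (auto simp: clockwise_once_around_def w_def)
    then have "((\<lambda>t. - c s / w * (f t / (t - a s))) has_contour_integral
        - c s / w * (w * winding_number \<Sigma> (a s) * f (a s))) \<Sigma>"
      by (rule has_contour_integral_lmul)
    moreover have "winding_number \<Sigma> (a s) = -1"
      using assms(2) s by (auto simp: clockwise_once_around_def)
    moreover have "- c s / w * (f t / (t - a s)) = f t * (c s / (a s - t)) / w" for t
    proof -
      have "- c s / (t - a s) = c s / (a s - t)"
        using minus_divide_divide[of "c s" "a s - t"] by simp
      then show ?thesis
        by (metis mult.commute times_divide_eq_left times_divide_eq_right)
    qed
    ultimately show ?thesis
      using w by simp
  qed
  then have "((\<lambda>t. \<Sum>s\<in>S. f t * (c s / (a s - t)) / w) has_contour_integral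
      (\<Sum>s\<in>S. c s * f (a s))) \<Sigma>"
    using assms(1) by (intro has_contour_integral_sum) auto
  then show ?thesis
    by (simp add: sum_distrib_left sum_divide_distrib flip: w_def)
qed

section \<open>Coefficients, factorials and Pochhammer symbols\<close>

lemma poly_eq_sum_less:
  fixes P :: "'a::comm_ring_1 poly"
  assumes "degree P < N"
  shows "poly P x = (\<Sum>k<N. coeff P k * x ^ k)"
  unfolding poly_altdef using assms
  by (intro sum.mono_neutral_left) (auto simp: coeff_eq_0)

text \<open>The factors with \<open>l < k\<close> are negative and give the signed
  \<open>fact k\<close>; those with \<open>l > k\<close> give
  \<open>fact (N - k - 1)\<close>.\<close>

lemma prod_integer_differences:
  assumes "k < N"
  shows "(\<Prod>l\<in>{..<N} - {k}. real l - real k) = fact k * fact (N - k - 1) * (-1) ^ k"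
proof -
  have split: "{..<N} - {k} = {..<k} \<union> {Suc k..<N}"
    using assms by auto
  have "(\<Prod>l<k. real l - real k) = pochhammer (- real k) k"
    by (simp add: pochhammer_prod lessThan_atLeast0)
  also have "\<dots> = (-1) ^ k * fact k"
    by (rule pochhammer_same)
  finally have low: "(\<Prod>l<k. real l - real k) = (-1) ^ k * fact k" .
  have "(\<Prod>l\<in>{Suc k..<Suc k + d}. real l - real k) = fact d" for d
    by (induction d) (simp_all add: algebra_simps)
  from this[of "N - k - 1"] assms
  have high: "(\<Prod>l\<in>{Suc k..<N}. real l - real k) = fact (N - k - 1)"
    by simp
  show ?thesis
    unfolding split by (subst prod.union_disjoint) (auto simp: low high)
qed

text \<open>Split \<open>pochhammer z (k + m)\<close> once after \<open>k\<close> factors and once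
  after \<open>m\<close> factors.\<close>

lemma pochhammer_add_of_nat:
  fixes z :: "'a::field_char_0"
  assumes "pochhammer z k \<noteq> 0"
  shows "pochhammer (z + of_nat k) m = pochhammer z m * pochhammer (z + of_nat m) k / pochhammer z k"
  using pochhammer_product'[of z k m] pochhammer_product'[of z m k] assms
  by (simp add: add.commute field_simps)

text \<open>Split \<open>pochhammer (z - of_nat k) (n + k)\<close> in two ways and reflect both
  blocks of length \<open>k\<close>; their signs \<open>(-1) ^ k\<close> cancel.\<close>

lemma pochhammer_diff_of_nat:
  fixes z :: "'a::field_char_0"
  assumes "pochhammer (1 - z - of_nat n) k \<noteq> 0"
  shows "pochhammer (z - of_nat k) n =
    pochhammer z n * pochhammer (1 - z) k / pochhammer (1 - z - of_nat n) k"
proof -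
  have "pochhammer (z - of_nat k) n * pochhammer (z - of_nat k + of_nat n) k =
      pochhammer (z - of_nat k) k * pochhammer z n"
    using pochhammer_product'[of "z - of_nat k" n k] pochhammer_product'[of "z - of_nat k" k n]
    by (simp add: add.commute)
  moreover have "pochhammer (z - of_nat k) k = (-1) ^ k * pochhammer (1 - z) k"
    using pochhammer_minus'[of "z - 1" k] by (simp add: algebra_simps)
  moreover have "pochhammer (z - of_nat k + of_nat n) k = (-1) ^ k * pochhammer (1 - z - of_nat n) k"
    using pochhammer_minus'[of "z + of_nat n - 1" k] by (simp add: algebra_simps)
  ultimately show ?thesis
    using assms by (simp add: field_simps)
qed

lemma pochhammer_nonint_nonzero:
  fixes z :: real
  assumes "z \<notin> \<int>"
  shows "pochhammer z k \<noteq> 0"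
  using assms by (auto simp: pochhammer_eq_0_iff)

text \<open>Reflection turns the terminating hypergeometric parameter into \<open>(-1) ^ k\<close>
  times the quotient of \<open>fact (n - 1)\<close> by \<open>fact (n - k - 1)\<close>.\<close>

lemma pochhammer_one_minus_nat:
  assumes "k < n"
  shows "pochhammer (- real n + 1) k / (fact k * fact (n - 1)) = 1 / (fact k * fact (n - k - 1) * (-1) ^ k)"
proof -
  have "fact (n - 1) = pochhammer (1::real) ((n - k - 1) + k)"
    using assms by (simp add: pochhammer_fact)
  also have "\<dots> = fact (n - k - 1) * pochhammer (real n - real k) k"
    unfolding pochhammer_product' using assms by (simp add: pochhammer_fact of_nat_diff)
  finally have f: "fact (n - 1) = fact (n - k - 1) * pochhammer (real n - real k) k" .
  have "pochhammer (- real n + 1) k = (-1) ^ k * pochhammer (real n - real k) k"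
    using pochhammer_minus[of "real n - 1" k] by (simp add: algebra_simps)
  moreover have "pochhammer (real n - real k) k \<noteq> 0"
    using f by (metis fact_nonzero mult_zero_right)
  moreover have "(-1::real) ^ k * (-1) ^ k = 1"
    by (simp flip: power_mult_distrib)
  ultimately show ?thesis
    unfolding f by (simp add: field_simps)
qed

text \<open>The coefficients in \<open>fps_hypergeo_nth\<close> are left folds over the parameter
  lists; this turns them into products.\<close>

lemma foldl_mult_eq_prod_list:
  fixes f :: "'b \<Rightarrow> 'a::comm_ring_1"
  shows "foldl (\<lambda>r x. r * f x) v xs = v * prod_list (map f xs)"
  by (induction xs arbitrary: v) (simp_all add: mult.assoc)

lemma prod_pochhammer_eq_prod_Sigma:
  fixes f :: "'b \<Rightarrow> 'a::comm_semiring_1"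
  assumes "finite I"
  shows "(\<Prod>i\<in>I. pochhammer (f i) (n i)) = (\<Prod>(i, k)\<in>Sigma I (\<lambda>i. {..<n i}). f i + of_nat k)"
  using assms by (simp add: prod.Sigma pochhammer_prod lessThan_atLeast0)

text \<open>A coincidence between two progressions would make the difference of their starting
  points an integer.\<close>

lemma inj_on_nonint_progressions:
  fixes f :: "'b \<Rightarrow> real"
  assumes "\<And>i h. i \<in> I \<Longrightarrow> h \<in> I \<Longrightarrow> i \<noteq> h \<Longrightarrow> f i - f h \<notin> \<int>"
  shows "inj_on (\<lambda>(i, k). f i + real k) (Sigma I (\<lambda>i. {..<n i}))"
proof (rule inj_onI, clarsimp)
  fix i k h l
  assume "i \<in> I" "h \<in> I" and eq: "f i + real k = f h + real l"
  have "f i - f h = of_int (int l - int k)"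
    using eq by simp
  then have "f i - f h \<in> \<int>"
    by (metis Ints_of_int)
  then have "i = h"
    using assms \<open>i \<in> I\<close> \<open>h \<in> I\<close> by blast
  then show "i = h \<and> k = l"
    using eq by simp
qed

section \<open>Poles, zeros and weights of the Pineiro system\<close>

locale pineiro_system =
  fixes p q :: nat and \<alpha> \<beta> :: "nat \<Rightarrow> real" and n m :: "nat \<Rightarrow> nat"
  assumes alpha_gt: "\<And>i. i \<in> {1..p} \<Longrightarrow> \<alpha> i > -1"
    and alpha_beta_gt: "\<And>i j. i \<in> {1..p} \<Longrightarrow> j \<in> {1..q} \<Longrightarrow> \<alpha> i + \<beta> j > -1"
    and alpha_nonint: "\<And>i h. i \<in> {1..p} \<Longrightarrow> h \<in> {1..p} \<Longrightarrow> i \<noteq> h \<Longrightarrow> \<alpha> i - \<alpha> h \<notin> \<int>"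
    and beta_nonint: "\<And>j s. j \<in> {1..q} \<Longrightarrow> s \<in> {1..q} \<Longrightarrow> j \<noteq> s \<Longrightarrow> \<beta> j - \<beta> s \<notin> \<int>"
    and size_eq: "(\<Sum>i=1..p. n i) = (\<Sum>j=1..q. m j) + 1"
begin

definition pole_index :: "(nat \<times> nat) set" where
  "pole_index = (SIGMA i:{1..p}. {..<n i})"

definition zero_index :: "(nat \<times> nat) set" where
  "zero_index = (SIGMA j:{1..q}. {..<m j})"

definition pole :: "nat \<times> nat \<Rightarrow> real" where
  "pole = (\<lambda>(i, k). \<alpha> i + real k)"

text \<open>The integral of \<open>x powr a * x powr (real k + \<beta> j)\<close> over the unit
  interval is \<open>1 / (a - zero (j, k))\<close>. These points are also the roots of the numerator
  of the contour integrand.\<close>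

definition zero :: "nat \<times> nat \<Rightarrow> real" where
  "zero = (\<lambda>(j, k). - (\<beta> j + real k + 1))"

text \<open>The claimed coefficient for the constant 1. It is the coefficient of
  \<open>1 / (pole (i, k) - t)\<close> in the partial fraction expansion of the rational factor of
  the contour integrand.\<close>

definition weight :: "nat \<Rightarrow> nat \<Rightarrow> real" where
  "weight i k = (\<Prod>j=1..q. pochhammer (\<alpha> i + real k + \<beta> j + 1) (m j)) /
    ((\<Prod>j\<in>{1..p} - {i}. pochhammer (\<alpha> j - \<alpha> i - real k) (n j)) *
      fact k * fact (n i - k - 1) * (-1) ^ k)"

lemma finite_pole_index: "finite pole_index"
  by (simp add: pole_index_def)

lemma finite_zero_index: "finite zero_index"
  by (simp add: zero_index_def)

lemma card_index: "card pole_index = card zero_index + 1"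
  using size_eq by (simp add: pole_index_def zero_index_def card_SigmaI)

lemma inj_on_pole: "inj_on pole pole_index"
  unfolding pole_def pole_index_def using alpha_nonint by (rule inj_on_nonint_progressions)

lemma inj_on_zero: "inj_on zero zero_index"
proof -
  have "inj_on (\<lambda>(j, k). \<beta> j + real k) zero_index"
    unfolding zero_index_def using beta_nonint by (rule inj_on_nonint_progressions)
  then show ?thesis
    by (force simp: inj_on_def zero_def)
qed

lemma pole_gt: "s \<in> pole_index \<Longrightarrow> pole s > -1"
  using alpha_gt by (force simp: pole_index_def pole_def)

text \<open>A consequence of \<open>\<alpha> i + \<beta> j > -1\<close>. It yields both the
  disjointness of zeros and poles and the integrability of the powers in the orthogonality
  relations.\<close>

lemma zero_less_pole: "s \<in> pole_index \<Longrightarrow> r \<in> zero_index \<Longrightarrow> zero r < pole s"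
  using alpha_beta_gt by (force simp: pole_index_def zero_index_def pole_def zero_def)

text \<open>Generic in the field: the real instance yields the coefficient formula, the complex one
  the contour integrand.\<close>

lemma poly_prod_zeros:
  fixes t :: "'a::real_normed_field"
  shows "poly (\<Prod>r\<in>zero_index. [:- of_real (zero r), 1:]) t =
    (\<Prod>j=1..q. pochhammer (t + of_real (\<beta> j) + 1) (m j))"
  by (simp add: poly_prod prod_pochhammer_eq_prod_Sigma zero_index_def zero_def split_def algebra_simps)

lemma prod_poles:
  fixes t :: "'a::real_normed_field"
  shows "(\<Prod>s\<in>pole_index. of_real (pole s) - t) = (\<Prod>i=1..p. pochhammer (of_real (\<alpha> i) - t) (n i))"
  by (simp add: prod_pochhammer_eq_prod_Sigma pole_index_def pole_def split_def algebra_simps)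

text \<open>Group the poles by progression: the other progressions give Pochhammer symbols, and the
  progression of \<open>i\<close> itself gives the factorials of
  \<open>prod_integer_differences\<close>.\<close>

lemma prod_pole_differences:
  assumes "(i, k) \<in> pole_index"
  shows "(\<Prod>r\<in>pole_index - {(i, k)}. pole r - pole (i, k)) =
    (\<Prod>j\<in>{1..p} - {i}. pochhammer (\<alpha> j - \<alpha> i - real k) (n j)) *
      (fact k * fact (n i - k - 1) * (-1) ^ k)"
proof -
  have split: "pole_index - {(i, k)} =
      (SIGMA j:{1..p} - {i}. {..<n j}) \<union> Pair i ` ({..<n i} - {k})"
    using assms by (auto simp: pole_index_def)
  have "(\<Prod>r\<in>(SIGMA j:{1..p} - {i}. {..<n j}). pole r - pole (i, k)) =
      (\<Prod>j\<in>{1..p} - {i}. pochhammer (\<alpha> j - \<alpha> i - real k) (n j))"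
    by (simp add: prod_pochhammer_eq_prod_Sigma pole_def split_def algebra_simps)
  moreover have "(\<Prod>r\<in>Pair i ` ({..<n i} - {k}). pole r - pole (i, k)) =
      fact k * fact (n i - k - 1) * (-1) ^ k"
    using assms prod_integer_differences[of k "n i"]
    by (subst prod.reindex) (auto simp: inj_on_def pole_def pole_index_def)
  ultimately show ?thesis
    unfolding split by (subst prod.union_disjoint) auto
qed

text \<open>Links the closed form \<open>weight\<close> to the quotient that occurs in
  \<open>cauchy_system_solution\<close> and \<open>partial_fractions\<close>.\<close>

lemma interpolation_coefficient:
  assumes "(i, k) \<in> pole_index"
  shows "poly (\<Prod>r\<in>zero_index. [:- zero r, 1:]) (pole (i, k)) /
    (\<Prod>r\<in>pole_index - {(i, k)}. pole r - pole (i, k)) = weight i k"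
  using poly_prod_zeros[of "pole (i, k)"]
  unfolding prod_pole_differences[OF assms] weight_def by (simp add: pole_def mult.assoc)

lemma pochhammer_alpha_beta_pos:
  assumes "i \<in> {1..p}" "j \<in> {1..q}"
  shows "pochhammer (\<alpha> i + real k + \<beta> j + 1) l > 0"
  using alpha_beta_gt[OF assms] by (intro pochhammer_pos) linarith

lemma weight_nonzero:
  assumes "(i, k) \<in> pole_index"
  shows "weight i k \<noteq> 0"
proof -
  have i: "i \<in> {1..p}"
    using assms by (simp add: pole_index_def)
  have "(\<Prod>j=1..q. pochhammer (\<alpha> i + real k + \<beta> j + 1) (m j)) \<noteq> 0"
    using pochhammer_alpha_beta_pos[OF i, of _ k] by (simp add: less_imp_neq[THEN not_sym])
  moreover have "(\<Prod>r\<in>pole_index - {(i, k)}. pole r - pole (i, k)) \<noteq> 0"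
    by (intro prod_node_differences_nonzero finite_pole_index inj_on_pole assms)
  ultimately show ?thesis
    by (simp add: prod_pole_differences[OF assms] weight_def)
qed

section \<open>Orthogonality as a Cauchy system, and uniqueness\<close>

lemma pineiro_form_expansion:
  assumes "\<And>i. i \<in> {1..p} \<Longrightarrow> if n i = 0 then A i = 0 else degree (A i) \<le> n i - 1" and "x \<ge> 0"
  shows "pineiro_form p \<alpha> A x = (\<Sum>s\<in>pole_index. coeff (A (fst s)) (snd s) * x powr pole s)"
proof -
  have "poly (A i) x * x powr \<alpha> i = (\<Sum>k<n i. coeff (A i) k * x powr (\<alpha> i + real k))"
    if i: "i \<in> {1..p}" for i
  proof -
    have "poly (A i) x = (\<Sum>k<n i. coeff (A i) k * x ^ k)"
    proof (cases "n i = 0")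
      case False
      then show ?thesis
        using assms(1)[OF i] by (intro poly_eq_sum_less) simp
    qed (use assms(1)[OF i] in simp)
    \<comment> \<open>At \<open>x = 0\<close> both sides are 0, because \<open>0 powr a = 0\<close>
      for every \<open>a\<close>.\<close>
    moreover have "x ^ k * x powr \<alpha> i = x powr (\<alpha> i + real k)" for k
      using assms(2) by (cases "x = 0") (simp_all add: powr_add powr_realpow mult.commute)
    ultimately show ?thesis
      by (simp add: sum_distrib_right mult.assoc)
  qed
  then show ?thesis
    by (simp add: pineiro_form_def pole_index_def pole_def sum.Sigma split_def)
qed

lemma has_integral_pineiro_form:
  assumes "\<And>i. i \<in> {1..p} \<Longrightarrow> if n i = 0 then A i = 0 else degree (A i) \<le> n i - 1"
    and jk: "(j, k) \<in> zero_index"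
  shows "((\<lambda>x. pineiro_form p \<alpha> A x * x powr (real k + \<beta> j)) has_integral
    (\<Sum>s\<in>pole_index. coeff (A (fst s)) (snd s) / (pole s - zero (j, k)))) {0..1}"
proof -
  let ?F = "\<lambda>x. (\<Sum>s\<in>pole_index. coeff (A (fst s)) (snd s) * x powr pole s) * x powr (real k + \<beta> j)"
  have "(?F has_integral (\<Sum>s\<in>pole_index. coeff (A (fst s)) (snd s) /
      (pole s - (- (real k + \<beta> j + 1))))) {0..1}"
  proof (rule has_integral_powr_sum[OF finite_pole_index])
    show "pole s + (real k + \<beta> j) > -1" if "s \<in> pole_index" for s
      using zero_less_pole[OF that jk] by (simp add: zero_def)
  qed
  moreover have "- (real k + \<beta> j + 1) = zero (j, k)"
    by (simp add: zero_def)
  ultimately have "(?F has_integral (\<Sum>s\<in>pole_index. coeff (A (fst s)) (snd s) /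
      (pole s - zero (j, k)))) {0..1}"
    by simp
  then show ?thesis
  proof (rule has_integral_eq[rotated])
    show "?F x = pineiro_form p \<alpha> A x * x powr (real k + \<beta> j)" if "x \<in> {0..1}" for x
    proof -
      have "x \<ge> 0"
        using that by simp
      with assms(1) have "pineiro_form p \<alpha> A x =
          (\<Sum>s\<in>pole_index. coeff (A (fst s)) (snd s) * x powr pole s)"
        by (rule pineiro_form_expansion)
      then show ?thesis
        by simp
    qed
  qed
qed

text \<open>Orthogonality is the Cauchy system for the poles and zeros, whose solutions form a line;
  the nontriviality of the form excludes the zero solution.\<close>

lemma type_I_coefficients:
  assumes "type_I_pineiro p q \<alpha> \<beta> n m A"
  shows "\<exists>C. C \<noteq> 0 \<and> (\<forall>i k. (i, k) \<in> pole_index \<longrightarrow> coeff (A i) k = C * weight i k)"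
proof -
  have deg: "if n i = 0 then A i = 0 else degree (A i) \<le> n i - 1" if "i \<in> {1..p}" for i
    using assms that unfolding type_I_pineiro_def by blast
  have orth: "(\<Sum>s\<in>pole_index. coeff (A (fst s)) (snd s) / (pole s - zero r)) = 0"
    if r: "r \<in> zero_index" for r
  proof -
    obtain j k where jk: "r = (j, k)" "(j, k) \<in> zero_index"
      using r by (cases r) auto
    then have "((\<lambda>x. pineiro_form p \<alpha> A x * x powr (real k + \<beta> j)) has_integral 0) {0..1}"
      using assms unfolding type_I_pineiro_def zero_index_def by auto
    then show ?thesis
      unfolding jk(1) using has_integral_pineiro_form[OF deg jk(2)] has_integral_unique by blast
  qed
  have "pole ` pole_index \<inter> zero ` zero_index = {}"
    using zero_less_pole by fastforce
  then obtain C where C: "\<forall>s\<in>pole_index. coeff (A (fst s)) (snd s) =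
      C * (poly (\<Prod>r\<in>zero_index. [:- zero r, 1:]) (pole s) /
        (\<Prod>r\<in>pole_index - {s}. pole r - pole s))"
    using cauchy_system_solution[OF finite_pole_index inj_on_pole finite_zero_index inj_on_zero
        card_index _ orth] by blast
  then have coeff: "coeff (A i) k = C * weight i k" if "(i, k) \<in> pole_index" for i k
    using that interpolation_coefficient[OF that] by fastforce
  moreover have "C \<noteq> 0"
  proof
    assume "C = 0"
    then have "pineiro_form p \<alpha> A x = 0" if "x \<ge> 0" for x
      using C pineiro_form_expansion[OF deg that] by simp
    then show False
      using assms unfolding type_I_pineiro_def by fastforce
  qed
  ultimately show ?thesis
    by blast
qed

section \<open>Existence: the explicit solution\<close>

definition explicit_component :: "nat \<Rightarrow> real poly" where
  "explicit_component i = (\<Sum>k<n i. monom (weight i k) k)"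

lemma coeff_explicit_component:
  "coeff (explicit_component i) k = (if k < n i then weight i k else 0)"
  by (simp add: explicit_component_def coeff_sum)

lemma degree_explicit_component:
  "if n i = 0 then explicit_component i = 0 else degree (explicit_component i) \<le> n i - 1"
  by (auto simp: explicit_component_def intro!: degree_sum_le order.trans[OF degree_monom_le])

text \<open>The residue sum of the contour integral, hence the reference form against which the
  constant is measured.\<close>

definition explicit_form :: "real \<Rightarrow> real" where
  "explicit_form x = (\<Sum>s\<in>pole_index. weight (fst s) (snd s) * x powr pole s)"

lemma pineiro_form_explicit_multiple:
  assumes "\<And>i. i \<in> {1..p} \<Longrightarrow> if n i = 0 then A i = 0 else degree (A i) \<le> n i - 1"
    and "\<And>i k. (i, k) \<in> pole_index \<Longrightarrow> coeff (A i) k = C * weight i k" and "x \<ge> 0"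
  shows "pineiro_form p \<alpha> A x = C * explicit_form x"
proof -
  have "pineiro_form p \<alpha> A x = (\<Sum>s\<in>pole_index. coeff (A (fst s)) (snd s) * x powr pole s)"
    using assms(1,3) by (rule pineiro_form_expansion)
  also have "\<dots> = (\<Sum>s\<in>pole_index. C * (weight (fst s) (snd s) * x powr pole s))"
    using assms(2) by (intro sum.cong refl) auto
  finally show ?thesis
    by (simp add: explicit_form_def sum_distrib_left)
qed

text \<open>Distinct powers are linearly independent on the open unit interval, all weights are
  nonzero, and \<open>card_index\<close> provides at least one pole.\<close>

lemma explicit_form_nonzero: "\<exists>x\<in>{0<..<1}. explicit_form x \<noteq> 0"
proof (rule ccontr)
  assume "\<not> ?thesis"
  then have zero: "(\<Sum>s\<in>pole_index. weight (fst s) (snd s) * x powr pole s) = 0"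
    if "x \<in> {0<..<1}" for x
    using that unfolding explicit_form_def by blast
  have "pole_index \<noteq> {}"
    using card_index by auto
  then obtain i k where ik: "(i, k) \<in> pole_index"
    by auto
  show False
    using powr_linearly_independent[OF finite_pole_index inj_on_pole pole_gt zero ik]
      weight_nonzero[OF ik] by simp
qed

text \<open>The partial fraction sum with these weights equals the product over the zeros divided by
  the product over the poles, so it vanishes at every \<open>zero (j, k)\<close>.\<close>

lemma type_I_explicit_component: "type_I_pineiro p q \<alpha> \<beta> n m explicit_component"
proof -
  \<comment> \<open>The factor 1 fits \<open>pineiro_form_explicit_multiple\<close> with
    \<open>C = 1\<close>.\<close>
  have coeff: "coeff (explicit_component i) k = 1 * weight i k" if "(i, k) \<in> pole_index" for i k
    using that by (auto simp: coeff_explicit_component pole_index_def)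
  have "\<exists>x\<in>{0<..<1}. pineiro_form p \<alpha> explicit_component x \<noteq> 0"
    using explicit_form_nonzero pineiro_form_explicit_multiple[OF degree_explicit_component coeff]
    by auto
  moreover have "((\<lambda>x. pineiro_form p \<alpha> explicit_component x * x powr (real k + \<beta> j)) has_integral 0) {0..1}"
    if "j \<in> {1..q}" "k < m j" for j k
  proof -
    have jk: "(j, k) \<in> zero_index"
      using that by (simp add: zero_index_def)
    define P where "P = (\<Prod>r\<in>zero_index. [:- zero r, 1:])"
    have "degree P < card pole_index"
      by (simp add: P_def degree_prod_linear card_index)
    moreover have "zero (j, k) \<notin> pole ` pole_index"
      using zero_less_pole[OF _ jk] by force
    ultimately have "poly P (zero (j, k)) / (\<Prod>s\<in>pole_index. pole s - zero (j, k)) =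
        (\<Sum>s\<in>pole_index. poly P (pole s) / (\<Prod>r\<in>pole_index - {s}. pole r - pole s) / (pole s - zero (j, k)))"
      by (rule partial_fractions[OF finite_pole_index inj_on_pole])
    also have "\<dots> = (\<Sum>s\<in>pole_index. coeff (explicit_component (fst s)) (snd s) / (pole s - zero (j, k)))"
    proof (intro sum.cong refl)
      fix s assume "s \<in> pole_index"
      then show "poly P (pole s) / (\<Prod>r\<in>pole_index - {s}. pole r - pole s) / (pole s - zero (j, k)) =
          coeff (explicit_component (fst s)) (snd s) / (pole s - zero (j, k))"
        using interpolation_coefficient[of "fst s" "snd s"] coeff[of "fst s" "snd s"]
        by (simp add: P_def del: divide_divide_eq_left)
    qed
    moreover have "poly P (zero (j, k)) = 0"
      unfolding P_def poly_prod using finite_zero_index jk by (intro prod_zero) auto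
    ultimately have "(\<Sum>s\<in>pole_index. coeff (explicit_component (fst s)) (snd s) / (pole s - zero (j, k))) = 0"
      by simp
    then show ?thesis
      using has_integral_pineiro_form[OF degree_explicit_component jk] by simp
  qed
  ultimately show ?thesis
    unfolding type_I_pineiro_def using degree_explicit_component by blast
qed

section \<open>The contour normalization\<close>

lemma has_contour_integral_explicit_form:
  assumes \<Sigma>: "clockwise_once_around \<Sigma> (pineiro_poles p \<alpha> n)" and x: "x > 0"
  shows "((\<lambda>t. complex_of_real x powr t *
      (\<Prod>j=1..q. pochhammer (t + of_real (\<beta> j) + 1) (m j)) /
      (\<Prod>i=1..p. pochhammer (of_real (\<alpha> i) - t) (n i)) / (2 * of_real pi * \<i>))
    has_contour_integral of_real (explicit_form x)) \<Sigma>"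
proof -
  define a where "a = (\<lambda>s. complex_of_real (pole s))"
  define c where "c = (\<lambda>s. complex_of_real (weight (fst s) (snd s)))"
  have poles: "pineiro_poles p \<alpha> n = a ` pole_index"
    unfolding pineiro_poles_def a_def pole_def pole_index_def by force
  have "((\<lambda>t. complex_of_real x powr t * (\<Sum>s\<in>pole_index. c s / (a s - t)) / (2 * of_real pi * \<i>))
      has_contour_integral (\<Sum>s\<in>pole_index. c s * complex_of_real x powr a s)) \<Sigma>"
    using \<Sigma> x unfolding poles
    by (intro has_contour_integral_partial_fractions finite_pole_index holomorphic_intros) auto
  moreover have "(\<Sum>s\<in>pole_index. c s * complex_of_real x powr a s) = of_real (explicit_form x)"
    using x by (simp add: c_def a_def explicit_form_def powr_of_real)
  \<comment> \<open>It suffices to compare the integrands on the contour, which avoids the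
    poles.\<close>
  moreover have "(\<Sum>s\<in>pole_index. c s / (a s - t)) =
      (\<Prod>j=1..q. pochhammer (t + of_real (\<beta> j) + 1) (m j)) /
      (\<Prod>i=1..p. pochhammer (of_real (\<alpha> i) - t) (n i))" if t: "t \<in> path_image \<Sigma>" for t
  proof -
    define P where "P = (\<Prod>r\<in>zero_index. [:- complex_of_real (zero r), 1:])"
    have "inj_on a pole_index"
      using inj_on_pole by (simp add: inj_on_def a_def)
    moreover have "degree P < card pole_index"
      by (simp add: P_def degree_prod_linear card_index)
    moreover have "t \<notin> a ` pole_index"
      using \<Sigma> t unfolding poles clockwise_once_around_def by blast
    ultimately have "poly P t / (\<Prod>s\<in>pole_index. a s - t) =
        (\<Sum>s\<in>pole_index. poly P (a s) / (\<Prod>r\<in>pole_index - {s}. a r - a s) / (a s - t))"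
      by (rule partial_fractions[OF finite_pole_index])
    moreover have "poly P (a s) / (\<Prod>r\<in>pole_index - {s}. a r - a s) = c s" if "s \<in> pole_index" for s
    proof -
      have "poly P (a s) = of_real (poly (\<Prod>r\<in>zero_index. [:- zero r, 1:]) (pole s))"
        by (simp add: P_def a_def poly_prod)
      moreover have "(\<Prod>r\<in>pole_index - {s}. a r - a s) =
          of_real (\<Prod>r\<in>pole_index - {s}. pole r - pole s)"
        by (simp add: a_def)
      moreover have "poly (\<Prod>r\<in>zero_index. [:- zero r, 1:]) (pole s) /
          (\<Prod>r\<in>pole_index - {s}. pole r - pole s) = weight (fst s) (snd s)"
        using interpolation_coefficient[of "fst s" "snd s"] that by simp
      ultimately show ?thesis
        unfolding c_def by (metis of_real_divide)
    qed
    ultimately have "(\<Sum>s\<in>pole_index. c s / (a s - t)) = poly P t / (\<Prod>s\<in>pole_index. a s - t)"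
      by simp
    then show ?thesis
      by (simp only: P_def a_def poly_prod_zeros prod_poles)
  qed
  ultimately show ?thesis
    by (auto elim: has_contour_integral_eq)
qed

section \<open>The hypergeometric representation\<close>

text \<open>The shift by \<open>k\<close> is moved out of each Pochhammer symbol:
  \<open>pochhammer_add_of_nat\<close> treats the factors with \<open>\<beta> j\<close>,
  \<open>pochhammer_diff_of_nat\<close> those with \<open>\<alpha> j\<close>, and
  \<open>pochhammer_one_minus_nat\<close> the factorials.\<close>

lemma weight_hypergeometric:
  assumes i: "i \<in> {1..p}" and k: "k < n i"
  shows "(\<Prod>j=1..q. pochhammer (\<alpha> i + \<beta> j + 1) (m j)) /
      (fact (n i - 1) * (\<Prod>j\<in>{1..p} - {i}. pochhammer (\<alpha> j - \<alpha> i) (n j))) *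
      (pochhammer (- real (n i) + 1) k *
        (\<Prod>j=1..q. pochhammer (\<alpha> i + \<beta> j + real (m j) + 1) k) *
        (\<Prod>j\<in>{1..p} - {i}. pochhammer (\<alpha> i - \<alpha> j - real (n j) + 1) k) /
        ((\<Prod>j=1..q. pochhammer (\<alpha> i + \<beta> j + 1) k) *
         (\<Prod>j\<in>{1..p} - {i}. pochhammer (\<alpha> i - \<alpha> j + 1) k) * fact k)) = weight i k"
proof -
  have "pochhammer (\<alpha> i + real k + \<beta> j + 1) (m j) = pochhammer (\<alpha> i + \<beta> j + 1) (m j) *
      pochhammer (\<alpha> i + \<beta> j + real (m j) + 1) k / pochhammer (\<alpha> i + \<beta> j + 1) k"
    if "j \<in> {1..q}" for j
    using pochhammer_add_of_nat[of "\<alpha> i + \<beta> j + 1" k "m j"] pochhammer_alpha_beta_pos[OF i that, of 0 k]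
    by (simp add: add_ac)
  then have num: "(\<Prod>j=1..q. pochhammer (\<alpha> i + real k + \<beta> j + 1) (m j)) =
      (\<Prod>j=1..q. pochhammer (\<alpha> i + \<beta> j + 1) (m j)) *
      (\<Prod>j=1..q. pochhammer (\<alpha> i + \<beta> j + real (m j) + 1) k) /
      (\<Prod>j=1..q. pochhammer (\<alpha> i + \<beta> j + 1) k)"
    by (simp add: prod_dividef prod.distrib)
  have "pochhammer (\<alpha> j - \<alpha> i - real k) (n j) = pochhammer (\<alpha> j - \<alpha> i) (n j) *
      pochhammer (\<alpha> i - \<alpha> j + 1) k / pochhammer (\<alpha> i - \<alpha> j - real (n j) + 1) k"
    if "j \<in> {1..p} - {i}" for j
  proof -
    \<comment> \<open>This keeps the denominator of \<open>pochhammer_diff_of_nat\<close> away from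
      0.\<close>
    have "\<alpha> i - \<alpha> j - real (n j) + 1 \<notin> \<int>"
    proof
      assume "\<alpha> i - \<alpha> j - real (n j) + 1 \<in> \<int>"
      then have "(\<alpha> i - \<alpha> j - real (n j) + 1) + (real (n j) - 1) \<in> \<int>"
        by (rule Ints_add) simp
      then show False
        using alpha_nonint[of i j] i that by auto
    qed
    then have "pochhammer (1 - (\<alpha> j - \<alpha> i) - real (n j)) k \<noteq> 0"
      using pochhammer_nonint_nonzero[of "\<alpha> i - \<alpha> j - real (n j) + 1" k] by (simp add: algebra_simps)
    then show ?thesis
      using pochhammer_diff_of_nat[of "\<alpha> j - \<alpha> i" "n j" k] by (simp add: algebra_simps)
  qed
  then have den: "(\<Prod>j\<in>{1..p} - {i}. pochhammer (\<alpha> j - \<alpha> i - real k) (n j)) =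
      (\<Prod>j\<in>{1..p} - {i}. pochhammer (\<alpha> j - \<alpha> i) (n j)) *
      (\<Prod>j\<in>{1..p} - {i}. pochhammer (\<alpha> i - \<alpha> j + 1) k) /
      (\<Prod>j\<in>{1..p} - {i}. pochhammer (\<alpha> i - \<alpha> j - real (n j) + 1) k)"
    by (simp add: prod_dividef prod.distrib)
  have "weight i k = (\<Prod>j=1..q. pochhammer (\<alpha> i + real k + \<beta> j + 1) (m j)) /
      (\<Prod>j\<in>{1..p} - {i}. pochhammer (\<alpha> j - \<alpha> i - real k) (n j)) *
      (1 / (fact k * fact (n i - k - 1) * (-1) ^ k))"
    by (simp add: weight_def mult.assoc)
  then show ?thesis
    unfolding num den pochhammer_one_minus_nat[OF k, symmetric]
    by (simp add: ac_simps)
qed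

text \<open>The parameter \<open>- real (n i) + 1\<close> is a nonpositive integer, so the series
  terminates and \<open>eval_fps\<close> is a finite sum, computed term by term with
  \<open>weight_hypergeometric\<close>.\<close>

lemma hypergeometric_component:
  assumes i: "i \<in> {1..p}" and ni: "n i \<ge> 1"
  shows "(\<Prod>j=1..q. pochhammer (\<alpha> i + \<beta> j + 1) (m j)) /
      (fact (n i - 1) * (\<Prod>j\<in>{1..p} - {i}. pochhammer (\<alpha> j - \<alpha> i) (n j))) *
      eval_fps
        (fps_hypergeo
           ([- real (n i) + 1]
            @ map (\<lambda>k. \<alpha> i + \<beta> k + real (m k) + 1) [1..<Suc q]
            @ map (\<lambda>k. \<alpha> i - \<alpha> k - real (n k) + 1) (removeAll i [1..<Suc p]))
           (map (\<lambda>k. \<alpha> i + \<beta> k + 1) [1..<Suc q]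
            @ map (\<lambda>k. \<alpha> i - \<alpha> k + 1) (removeAll i [1..<Suc p]))
           1)
        x = (\<Sum>k<n i. weight i k * x ^ k)" (is "?c * eval_fps ?H x = _")
proof -
  have list_q: "prod_list (map g [1..<Suc q]) = (\<Prod>j=1..q. g j)" for g :: "nat \<Rightarrow> real"
    using prod.distinct_set_conv_list[of "[1..<Suc q]" g]
    by (simp add: atLeastLessThanSuc_atLeastAtMost del: upt_Suc)
  have list_p: "prod_list (map g (removeAll i [1..<Suc p])) = (\<Prod>j\<in>{1..p} - {i}. g j)"
    for g :: "nat \<Rightarrow> real"
    using prod.distinct_set_conv_list[of "removeAll i [1..<Suc p]" g]
    by (simp add: atLeastLessThanSuc_atLeastAtMost distinct_removeAll del: upt_Suc)
  have nth: "fps_nth ?H k = pochhammer (- real (n i) + 1) k *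
        (\<Prod>j=1..q. pochhammer (\<alpha> i + \<beta> j + real (m j) + 1) k) *
        (\<Prod>j\<in>{1..p} - {i}. pochhammer (\<alpha> i - \<alpha> j - real (n j) + 1) k) /
        ((\<Prod>j=1..q. pochhammer (\<alpha> i + \<beta> j + 1) k) *
         (\<Prod>j\<in>{1..p} - {i}. pochhammer (\<alpha> i - \<alpha> j + 1) k) * fact k)" for k
    unfolding fps_hypergeo_nth foldl_mult_eq_prod_list map_append prod_list.append map_map o_def
      list_q list_p by (simp add: mult.assoc)
  have vanish: "fps_nth ?H k = 0" if "k \<notin> {..<n i}" for k
  proof -
    have "pochhammer (- real (n i) + 1) k = 0"
      \<comment> \<open>The factor of index \<open>n i - 1\<close> is 0, and it is present exactly
        when \<open>k\<close> is at least \<open>n i\<close>.\<close>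
      unfolding pochhammer_eq_0_iff using that ni by (intro exI[of _ "n i - 1"]) (auto simp: of_nat_diff)
    then show ?thesis
      unfolding nth by simp
  qed
  have "eval_fps ?H x = (\<Sum>k<n i. fps_nth ?H k * x ^ k)"
    unfolding eval_fps_def
  proof (rule suminf_finite[OF finite_lessThan])
    show "fps_nth ?H k * x ^ k = 0" if "k \<notin> {..<n i}" for k
      unfolding vanish[OF that] by simp
  qed
  then have "?c * eval_fps ?H x = (\<Sum>k<n i. ?c * fps_nth ?H k * x ^ k)"
    by (simp add: sum_distrib_left mult.assoc)
  also have "\<dots> = (\<Sum>k<n i. weight i k * x ^ k)"
    unfolding nth using weight_hypergeometric[OF i] by (intro sum.cong refl) simp
  finally show ?thesis .
qed

end

section \<open>Existence, uniqueness and the explicit formulas combined\<close>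

theorem corollary5p2:
  fixes p q :: nat
    and \<alpha> \<beta> :: "nat \<Rightarrow> real"
    and n m :: "nat \<Rightarrow> nat"
  assumes "p \<ge> 1" and "q \<ge> 1"
    and "\<And>i. i \<in> {1..p} \<Longrightarrow> \<alpha> i > -1"
    and "\<And>j. j \<in> {1..q} \<Longrightarrow> \<beta> j > -1"
    and "\<And>i j. i \<in> {1..p} \<Longrightarrow> j \<in> {1..q} \<Longrightarrow> \<alpha> i + \<beta> j > -1"
    and "\<And>i h. i \<in> {1..p} \<Longrightarrow> h \<in> {1..p} \<Longrightarrow> i \<noteq> h \<Longrightarrow> \<alpha> i - \<alpha> h \<notin> \<int>"
    and "\<And>j s. j \<in> {1..q} \<Longrightarrow> s \<in> {1..q} \<Longrightarrow> j \<noteq> s \<Longrightarrow> \<beta> j - \<beta> s \<notin> \<int>"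
    and "(\<Sum>i=1..p. n i) = (\<Sum>j=1..q. m j) + 1"
  shows
    "(\<exists>A. type_I_pineiro p q \<alpha> \<beta> n m A) \<and>
     (\<forall>A. type_I_pineiro p q \<alpha> \<beta> n m A \<longrightarrow>
       (\<exists>c::real. c \<noteq> 0 \<and>
         (\<forall>\<Sigma>. clockwise_once_around \<Sigma> (pineiro_poles p \<alpha> n) \<longrightarrow>
            (pineiro_contour_normalized p q \<alpha> \<beta> n m \<Sigma> A \<longleftrightarrow> c = 1)) \<and>
         (\<forall>i\<in>{1..p}. n i \<ge> 1 \<longrightarrow>
            (\<forall>x::real. poly (A i) x =
               c * ((\<Prod>j=1..q. pochhammer (\<alpha> i + \<beta> j + 1) (m j)) /
                    (fact (n i - 1) * (\<Prod>j\<in>{1..p} - {i}. pochhammer (\<alpha> j - \<alpha> i) (n j))) *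
                    eval_fps
                      (fps_hypergeo
                         ([- real (n i) + 1]
                          @ map (\<lambda>k. \<alpha> i + \<beta> k + real (m k) + 1) [1..<Suc q]
                          @ map (\<lambda>k. \<alpha> i - \<alpha> k - real (n k) + 1) (removeAll i [1..<Suc p]))
                         (map (\<lambda>k. \<alpha> i + \<beta> k + 1) [1..<Suc q]
                          @ map (\<lambda>k. \<alpha> i - \<alpha> k + 1) (removeAll i [1..<Suc p]))
                         1)
                      x)) \<and>
            (\<forall>k\<le>n i - 1. coeff (A i) k =
               c * ((\<Prod>j=1..q. pochhammer (\<alpha> i + real k + \<beta> j + 1) (m j)) /
                    ((\<Prod>j\<in>{1..p} - {i}. pochhammer (\<alpha> j - \<alpha> i - real k) (n j)) *
                     fact k * fact (n i - k - 1) * (-1) ^ k))) \<and>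
            coeff (A i) (n i - 1) =
               c * ((\<Prod>j=1..q. pochhammer (\<alpha> i + real (n i) + \<beta> j) (m j)) /
                    ((\<Prod>j\<in>{1..p} - {i}. pochhammer (\<alpha> j - \<alpha> i - real (n i) + 1) (n j)) *
                     fact (n i - 1) * (-1) ^ (n i - 1))))))"
proof -
  interpret pineiro_system p q \<alpha> \<beta> n m
    using assms(3,5-8) by unfold_locales
  show ?thesis
  proof (intro conjI allI impI, goal_cases)
    case 1
    show ?case
      using type_I_explicit_component by blast
  next
    case (2 A)
    have deg: "if n i = 0 then A i = 0 else degree (A i) \<le> n i - 1" if "i \<in> {1..p}" for i
      using 2 that unfolding type_I_pineiro_def by blast
    obtain C where C: "C \<noteq> 0" and coeff: "\<And>i k. (i, k) \<in> pole_index \<Longrightarrow> coeff (A i) k = C * weight i k"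
      using type_I_coefficients[OF 2] by blast
    have form: "pineiro_form p \<alpha> A x = C * explicit_form x" if "x > 0" for x
      using pineiro_form_explicit_multiple[OF deg coeff, of x] that by simp
    have contour: "pineiro_contour_normalized p q \<alpha> \<beta> n m \<Sigma> A \<longleftrightarrow> C = 1"
      if \<Sigma>: "clockwise_once_around \<Sigma> (pineiro_poles p \<alpha> n)" for \<Sigma>
    proof
      assume norm: "pineiro_contour_normalized p q \<alpha> \<beta> n m \<Sigma> A"
      \<comment> \<open>At a point where the reference form is nonzero, uniqueness of the contour
        integral determines \<open>C\<close>.\<close>
      obtain x where x: "x > 0" "explicit_form x \<noteq> 0"
        using explicit_form_nonzero by auto
      have "complex_of_real (pineiro_form p \<alpha> A x) = of_real (explicit_form x)"
        using norm has_contour_integral_explicit_form[OF \<Sigma> x(1)] x(1)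
        unfolding pineiro_contour_normalized_def by (blast intro: has_contour_integral_unique)
      then show "C = 1"
        using form[OF x(1)] x(2) by simp
    next
      assume "C = 1"
      then show "pineiro_contour_normalized p q \<alpha> \<beta> n m \<Sigma> A"
        using has_contour_integral_explicit_form[OF \<Sigma>] form
        unfolding pineiro_contour_normalized_def by simp
    qed
    have coeff': "coeff (A i) k = C * weight i k" if "i \<in> {1..p}" "n i \<ge> 1" "k \<le> n i - 1" for i k
      using coeff[of i k] that by (simp add: pole_index_def)
    have poly: "poly (A i) x = C * (\<Sum>k<n i. weight i k * x ^ k)" if i: "i \<in> {1..p}" "n i \<ge> 1" for i x
    proof -
      have "poly (A i) x = (\<Sum>k<n i. coeff (A i) k * x ^ k)"
        using deg[OF i(1)] i(2) by (intro poly_eq_sum_less) simp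
      also have "\<dots> = C * (\<Sum>k<n i. weight i k * x ^ k)"
        using coeff'[OF i] by (simp add: sum_distrib_left mult.assoc)
      finally show ?thesis .
    qed
    have lead: "coeff (A i) (n i - 1) =
        C * ((\<Prod>j=1..q. pochhammer (\<alpha> i + real (n i) + \<beta> j) (m j)) /
          ((\<Prod>j\<in>{1..p} - {i}. pochhammer (\<alpha> j - \<alpha> i - real (n i) + 1) (n j)) *
            fact (n i - 1) * (-1) ^ (n i - 1)))" if i: "i \<in> {1..p}" "n i \<ge> 1" for i
    proof -
      \<comment> \<open>Since \<open>n i\<close> is at least 1, the truncated subtraction is exact;
        at \<open>k = n i - 1\<close> the factor \<open>fact (n i - k - 1)\<close> becomes
        \<open>fact 0\<close>.\<close>
      have "\<alpha> i + real (n i - 1) + \<beta> j + 1 = \<alpha> i + real (n i) + \<beta> j"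
        "\<alpha> j - \<alpha> i - real (n i - 1) = \<alpha> j - \<alpha> i - real (n i) + 1" for j
        using i(2) by (simp_all add: of_nat_diff)
      moreover have "n i - (n i - 1) - 1 = 0"
        by simp
      ultimately show ?thesis
        unfolding coeff'[OF i order.refl] weight_def by (simp only: fact_0 mult_1_right)
    qed
    show ?case
      by (intro exI[of _ C] conjI allI impI ballI)
        (rule C contour coeff'[unfolded weight_def] lead; assumption |
          simp only: poly hypergeometric_component)+
  qed
qed

end
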